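(* Let $(p_1,\dots,p_n)$ be a growth sequence, let $(\lambda,L)$ be the Dyck path with natural labeling it determines, let $\sigma=L_0\circ L^{-1}$, and let $w$ be the min-word of $\operatorname{match}(p_1,\dots,p_n)$. Then $\operatorname{DES}(\sigma)=\operatorname{DES}(w)$. In particular, $\operatorname{dis}(\operatorname{DTR}(p_1,\dots,p_n))=\operatorname{des}(w)$.
   Context: For a word $w=w_1\cdots w_n$, $\operatorname{DES}(w)=\{i<n:w_i>w_{i+1}\}$ and $\operatorname{des}(w)=|\operatorname{DES}(w)|$. Dyck paths. A Dyck path of order $n$ is a lattice path from $(-n,0)$ to $(n,0)$ with steps $(+1,+1)$ (up) and $(+1,-1)$ (down) never going below the $x$-axis; $\rho(x)$ is its height at $x$; steps are numbered $1,\dots,2n$ left to right. Column $s$ is the line $x=s$. Each up step is matched with a down step as in balanced parentheses; such a pair is a chord. Chord poset $P_\lambda$: $c<c'$ iff both steps of $c'$ lie strictly between those of $c$. A natural labeling is a bijection $L:P_\lambda\to[n]$ with $L(c)<L(c')$ whenever $c<c'$; $L_0$ numbers chords by the left-to-right order of their up steps. Growth sequences. A growth sequence of length $n$ is $(p_1,\dots,p_n)$ with integers $0\le p_i\le 2(i-1)$. It determines $(\lambda,L)$: start with the empty word, and for $i=1,\dots,n$ insert UD immediately after the first $p_i$ letters of the current word, labeling the new chord $i$. Matchings. $\operatorname{match}()$ is the empty matching; $\operatorname{match}(p_1,\dots,p_n)$ is obtained from $\operatorname{match}(p_1,\dots,p_{n-1})$ (a perfect matching of $[2n-2]$) by increasing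 by $1$ every number larger than $p_n$ and adjoining the pair $\{p_n+1,2n\}$. The min-word of a perfect matching of $[2n]$ lists the smaller element of each pair, ordered by increasing larger element. Dyck tilings. A box is a square with vertices $(x,y),(x+1,y+1),(x,y+2),(x-1,y+1)$ (lower corner $(x,y)$, column $x$). For Dyck paths $\lambda,\mu$ of order $n$ with $\mu$ weakly above $\lambda$, a Dyck tiling of $\lambda/\mu$ is a partition of the boxes between them into Dyck tiles: nonempty sets of boxes, one in each of a set of consecutive columns, whose lower corners read left to right form a lattice path with steps $(+1,\pm1)$ with first and last points of equal height and none lower. $\operatorname{dis}(T)$ is the number of $k$ with step $k$ of $\lambda$ down and step $k$ of $\mu$ up. Spread. The spread at column $s$ of a path $\rho$ is $\{(x-1,y):(x,y)\in\rho,x\le s\}\cup\{(x,y+1):(x,y)\in\rho,x=s\}\cup\{(x+1,y):(x,y)\in\rho,x\ge s\}$; spreading a tiling spreads its lower path, upper path and all tile lower-corner paths. For a tiling $T$ with upper path $\mu$, column $s$ is eligible if $\mu$ has an up step ending in column $s$ and the point of $\mu$ at column $s$ is not the top corner of a one-box tile; the special column is the rightmost eligible column. DTR. For $T$ of order $n$ and $-n\le s\le n$, let $T''$ be the spread of $T$ at $s$, with upper path $\mu''$ and special column $Q$; $\mathrm{rgrow}(T,s)$ is $T''$ together with, if $Q>s$, the one-box tiles with lower corners $(c,\mu''(c))$ for $s<c<Q$. $\operatorname{DTR}()$ is the empty tiling of order $0$ and $\operatorname{DTR}(p_1,\dots,p_n)=\mathrm{rgrow}(\operatorname{DTR}(p_1,\dots,p_{n-1}),p_n-(n-1))$.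 *)

theory Defs
  imports Main
begin

section \<open>Words and descents\<close>

text \<open>Words are lists; their letters are numbered from 1, so letter \<open>i\<close> of \<open>w\<close> is \<open>w ! (i - 1)\<close>.\<close>

definition DES :: "nat list \<Rightarrow> nat set" where
  "DES w = {i. 1 \<le> i \<and> i < length w \<and> w ! (i - 1) > w ! i}"

definition des :: "nat list \<Rightarrow> nat" where
  "des w = card (DES w)"


section \<open>Growth sequences and labeled Dyck paths\<close>

text \<open>A sequence $(p_1,\dots,p_n)$ is a function of which only the values at \<open>1, \<dots>, n\<close> matter.\<close>

definition growth_sequence :: "nat \<Rightarrow> (nat \<Rightarrow> nat) \<Rightarrow> bool" where
  "growth_sequence n p \<longleftrightarrow> (\<forall>i\<in>{1..n}. p i \<le> 2 * (i - 1))"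

datatype step = Up | Down

definition dyck_word :: "step list \<Rightarrow> bool" where
  "dyck_word w \<longleftrightarrow> count_list w Up = count_list w Down \<and>
     (\<forall>k\<le>length w. count_list (take k w) Down \<le> count_list (take k w) Up)"

text \<open>A chord is the pair of the numbers of its two steps: an up step \<open>a\<close> matches a later down
  step \<open>b\<close> iff the steps strictly between them are balanced.\<close>

definition chords :: "step list \<Rightarrow> (nat \<times> nat) set" where
  "chords w = {(a, b). 1 \<le> a \<and> a < b \<and> b \<le> length w \<and> w ! (a - 1) = Up \<and> w ! (b - 1) = Down \<and>
     dyck_word (take (b - a - 1) (drop a w))}"

text \<open>Each letter carries the label of the chord it belongs to.\<close>

primrec labeled_word :: "(nat \<Rightarrow> nat) \<Rightarrow> nat \<Rightarrow> (step \<times> nat) list" where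
  "labeled_word p 0 = []"
| "labeled_word p (Suc n) =
     take (p (Suc n)) (labeled_word p n) @ [(Up, Suc n), (Down, Suc n)] @
     drop (p (Suc n)) (labeled_word p n)"

definition grown_path :: "(nat \<Rightarrow> nat) \<Rightarrow> nat \<Rightarrow> step list" where
  "grown_path p n = map fst (labeled_word p n)"

definition grown_labeling :: "(nat \<Rightarrow> nat) \<Rightarrow> nat \<Rightarrow> nat \<times> nat \<Rightarrow> nat" where
  "grown_labeling p n c = snd (labeled_word p n ! (fst c - 1))"

definition L0 :: "step list \<Rightarrow> nat \<times> nat \<Rightarrow> nat" where
  "L0 w c = card {c' \<in> chords w. fst c' \<le> fst c}"

text \<open>The permutation $L_0 \circ L^{-1}$ of \<open>{1..n}\<close> in one-line notation.\<close>

definition sigma :: "(nat \<Rightarrow> nat) \<Rightarrow> nat \<Rightarrow> nat list" where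
  "sigma p n = map (L0 (grown_path p n) \<circ> the_inv_into (chords (grown_path p n)) (grown_labeling p n))
     [1..<Suc n]"


section \<open>Matchings\<close>

primrec match :: "(nat \<Rightarrow> nat) \<Rightarrow> nat \<Rightarrow> nat set set" where
  "match p 0 = {}"
| "match p (Suc n) =
     insert {p (Suc n) + 1, 2 * Suc n}
       ((\<lambda>e. (\<lambda>a. if a > p (Suc n) then a + 1 else a) ` e) ` match p n)"

definition min_word :: "nat set set \<Rightarrow> nat list" where
  "min_word M = map (\<lambda>m. Min (THE e. e \<in> M \<and> Max e = m)) (sorted_list_of_set (Max ` M))"


section \<open>Tilings, spreads and the map DTR\<close>

text \<open>Paths are sets of lattice points. A box is represented by its lower corner, so a tile is the
  same set as its lower-corner path. The record does not require that the tiles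
  form a Dyck tiling of the region between the two paths, and the operations below are defined
  on arbitrary data; they are only meaningful for Dyck tilings.\<close>

type_synonym point = "int \<times> int"

record tiling =
  tiling_order :: nat
  lower_path :: "point set"
  upper_path :: "point set"
  tiles :: "point set set"

definition up_into :: "point set \<Rightarrow> int \<Rightarrow> bool" where
  "up_into P s \<longleftrightarrow> (\<exists>y. (s - 1, y) \<in> P \<and> (s, y + 1) \<in> P)"

definition down_into :: "point set \<Rightarrow> int \<Rightarrow> bool" where
  "down_into P s \<longleftrightarrow> (\<exists>y. (s - 1, y) \<in> P \<and> (s, y - 1) \<in> P)"

text \<open>Step \<open>k\<close> of a path of order \<open>n\<close> ends in column \<open>k - n\<close>.\<close>

definition dis :: "tiling \<Rightarrow> nat" where
  "dis T = card {k \<in> {1..2 * tiling_order T}.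
     down_into (lower_path T) (int k - int (tiling_order T)) \<and>
     up_into (upper_path T) (int k - int (tiling_order T))}"

definition spread :: "int \<Rightarrow> point set \<Rightarrow> point set" where
  "spread s P = {(x - 1, y) | x y. (x, y) \<in> P \<and> x \<le> s}
     \<union> {(x, y + 1) | x y. (x, y) \<in> P \<and> x = s}
     \<union> {(x + 1, y) | x y. (x, y) \<in> P \<and> x \<ge> s}"

definition spread_tiling :: "int \<Rightarrow> tiling \<Rightarrow> tiling" where
  "spread_tiling s T =
     \<lparr>tiling_order = Suc (tiling_order T),
      lower_path = spread s (lower_path T),
      upper_path = spread s (upper_path T),
      tiles = spread s ` tiles T\<rparr>"

text \<open>The top corner of the box with lower corner \<open>(x, y)\<close> is \<open>(x, y + 2)\<close>.\<close>

definition eligible :: "tiling \<Rightarrow> int \<Rightarrow> bool" where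
  "eligible T s \<longleftrightarrow> up_into (upper_path T) s \<and>
     \<not> (\<exists>y. (s, y + 2) \<in> upper_path T \<and> {(s, y)} \<in> tiles T)"

definition special_column :: "tiling \<Rightarrow> int" where
  "special_column T = Max {s. eligible T s}"

text \<open>The added one-box tiles raise the upper path by 2 in their columns. For \<open>Q \<le> s\<close> there are
  no columns strictly between \<open>s\<close> and \<open>Q\<close>, so nothing is added.\<close>

definition add_boxes :: "int \<Rightarrow> int \<Rightarrow> tiling \<Rightarrow> tiling" where
  "add_boxes s Q T = T
     \<lparr>upper_path := {(x, y) | x y. (x, y) \<in> upper_path T \<and> \<not> (s < x \<and> x < Q)}
        \<union> {(x, y + 2) | x y. (x, y) \<in> upper_path T \<and> s < x \<and> x < Q},
      tiles := tiles T \<union> {{(c, y)} | c y. (c, y) \<in> upper_path T \<and> s < c \<and> c < Q}\<rparr>"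

definition rgrow :: "tiling \<Rightarrow> int \<Rightarrow> tiling" where
  "rgrow T s = (let T'' = spread_tiling s T in add_boxes s (special_column T'') T'')"

primrec DTR :: "(nat \<Rightarrow> nat) \<Rightarrow> nat \<Rightarrow> tiling" where
  "DTR p 0 = \<lparr>tiling_order = 0, lower_path = {(0, 0)}, upper_path = {(0, 0)}, tiles = {}\<rparr>"
| "DTR p (Suc n) = rgrow (DTR p n) (int (p (Suc n)) - int n)"

end

theory Submission
  imports Defs "HOL-Library.Sublist"
begin

text \<open>All three quantities are governed by the indices \<open>i\<close> with \<open>p (i + 1) \<le> p i\<close>.
  Later insertions preserve the left-to-right order of existing up steps, and the up step \<open>i + 1\<close>
  is inserted to the left of the up step \<open>i\<close> exactly when \<open>p (i + 1) \<le> p i\<close>. Each matching step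
  appends \<open>p (i + 1) + 1\<close> to the min-word after raising its letters above \<open>p (i + 1)\<close>, which gives
  the same criterion. After growing at column \<open>s\<close>, the special column is \<open>s\<close>: every up step to the
  right of it is either flattened or covered by a new one-box tile. Hence at the next step boxes are
  added iff the new column lies to the left of the previous one, that is, iff
  \<open>p (i + 1) \<le> p i\<close>; the boxes turn the down step after the new peak into an up step of the upper
  path, and the up step they destroy was not counted by \<open>dis\<close>, since the lower path was spread in
  that column and goes up there too.\<close>

section \<open>Descents of words\<close>

lemma DES_snoc:
  "DES (xs @ [x]) = DES xs \<union> {i. i = length xs \<and> xs \<noteq> [] \<and> last xs > x}"
  by (cases "xs = []")
    (auto simp: DES_def nth_append last_conv_nth less_Suc_eq Suc_le_eq split: if_splits)

lemma DES_map:
  fixes f :: "nat \<Rightarrow> nat"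
  assumes "strict_mono f"
  shows "DES (map f xs) = DES xs"
  using assms by (auto simp: DES_def strict_mono_less)

text \<open>The common value of the two descent sets, and by cardinality of \<open>dis\<close>.
  Equality counts because a peak inserted at the previous position lands before the previous
  peak.\<close>

definition weak_drops :: "(nat \<Rightarrow> nat) \<Rightarrow> nat \<Rightarrow> nat set" where
  "weak_drops p n = {i. 1 \<le> i \<and> i < n \<and> p (Suc i) \<le> p i}"

lemma weak_drops_0 [simp]: "weak_drops p 0 = {}"
  by (simp add: weak_drops_def)

lemma weak_drops_Suc:
  "weak_drops p (Suc n) = weak_drops p n \<union> {i. i = n \<and> 1 \<le> n \<and> p (Suc n) \<le> p n}"
  by (auto simp: weak_drops_def less_Suc_eq)

lemma finite_weak_drops [simp]: "finite (weak_drops p n)"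
  by (simp add: weak_drops_def)

lemma card_weak_drops_Suc:
  "card (weak_drops p (Suc n)) =
     card (weak_drops p n) + (if 1 \<le> n \<and> p (Suc n) \<le> p n then 1 else 0)"
proof -
  have "n \<notin> weak_drops p n" by (simp add: weak_drops_def)
  then show ?thesis by (auto simp: weak_drops_Suc)
qed

lemma growth_sequence_Suc:
  "growth_sequence (Suc n) p \<longleftrightarrow> growth_sequence n p \<and> p (Suc n) \<le> 2 * n"
  by (auto simp: growth_sequence_def atLeastAtMostSuc_conv)


section \<open>The min-word of a matching\<close>

text \<open>Names the anonymous renumbering inside \<open>match\<close>, so that it can be used as a
  strictly monotone map: it commutes with \<open>Min\<close> and \<open>Max\<close> and preserves
  descents.\<close>

definition shift_above :: "nat \<Rightarrow> nat \<Rightarrow> nat" where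
  "shift_above k a = (if a > k then a + 1 else a)"

lemma strict_mono_shift_above: "strict_mono (shift_above k)"
  by (auto simp: strict_mono_def shift_above_def)

lemma match_Suc: "match p (Suc n) =
    insert {p (Suc n) + 1, 2 * Suc n} ((`) (shift_above (p (Suc n))) ` match p n)"
  by (simp add: shift_above_def [abs_def])

lemma finite_match: "finite (match p n)"
  by (induction n) auto

lemma match_edges:
  assumes "growth_sequence n p" "e \<in> match p n"
  shows "finite e \<and> e \<noteq> {} \<and> e \<subseteq> {1..2 * n}"
  using assms
proof (induction n arbitrary: e)
  case (Suc n)
  then have IH: "\<And>e. e \<in> match p n \<Longrightarrow> finite e \<and> e \<noteq> {} \<and> e \<subseteq> {1..2 * n}"
    and p: "p (Suc n) \<le> 2 * n" by (auto simp: growth_sequence_Suc)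
  show ?case
  proof (cases "e = {p (Suc n) + 1, 2 * Suc n}")
    case True
    then show ?thesis using p by auto
  next
    case False
    then obtain e' where "e' \<in> match p n" "e = shift_above (p (Suc n)) ` e'"
      using Suc.prems by (auto simp: match_Suc simp del: match.simps)
    then show ?thesis using IH[of e'] by (fastforce simp: shift_above_def)
  qed
qed simp

lemma Max_match_le:
  assumes "growth_sequence n p" "e \<in> match p n"
  shows "Max e \<le> 2 * n"
  using match_edges[OF assms] by auto

lemma Max_image_shift_above:
  assumes "growth_sequence n p" "e \<in> match p n"
  shows "Max (shift_above k ` e) = shift_above k (Max e)"
  using match_edges[OF assms] mono_Max_commute[OF strict_mono_mono[OF strict_mono_shift_above]]
  by simp

lemma Min_image_shift_above:
  assumes "growth_sequence n p" "e \<in> match p n"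
  shows "Min (shift_above k ` e) = shift_above k (Min e)"
  using match_edges[OF assms] mono_Min_commute[OF strict_mono_mono[OF strict_mono_shift_above]]
  by simp

lemma Max_shifted_less:
  assumes "growth_sequence n p" "e \<in> match p n"
  shows "Max (shift_above k ` e) < 2 * Suc n"
  using Max_image_shift_above[OF assms, of k] Max_match_le[OF assms]
  by (simp add: shift_above_def)

text \<open>This makes the \<open>THE\<close> in \<open>min_word\<close> well determined. Shifting
  keeps old maxima distinct and at most \<open>2 * n + 1\<close>, below the maximum
  \<open>2 * n + 2\<close> of the new pair.\<close>

lemma inj_on_Max_match:
  assumes "growth_sequence n p"
  shows "inj_on Max (match p n)"
  using assms
proof (induction n)
  case (Suc n)
  let ?f = "shift_above (p (Suc n))"
  from Suc have g: "growth_sequence n p" and p: "p (Suc n) \<le> 2 * n"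
    and IH: "inj_on Max (match p n)" by (auto simp: growth_sequence_Suc)
  have "inj_on (\<lambda>e. Max (?f ` e)) (match p n)"
    using IH by (auto simp: inj_on_def Max_image_shift_above[OF g]
        strict_mono_eq[OF strict_mono_shift_above])
  then have "inj_on Max ((`) ?f ` match p n)"
    by (auto simp: inj_on_def)
  moreover have "Max {p (Suc n) + 1, 2 * Suc n} \<notin> Max ` ((`) ?f ` match p n)"
    using p Max_shifted_less[OF g, of _ "p (Suc n)"] by fastforce
  ultimately show ?case unfolding match_Suc by (subst inj_on_insert) blast
qed simp

lemma the_edge_with_Max:
  assumes "inj_on Max M" "e \<in> M"
  shows "(THE e'. e' \<in> M \<and> Max e' = Max e) = e"
  using assms by (auto dest: inj_onD intro!: the_equality)

text \<open>The shift keeps the old pairs in their order, and the new pair has the greatest larger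
  element, so its smaller element comes last.\<close>

lemma min_word_match_Suc:
  assumes "growth_sequence (Suc n) p"
  shows "min_word (match p (Suc n)) =
    map (shift_above (p (Suc n))) (min_word (match p n)) @ [p (Suc n) + 1]"
proof -
  let ?f = "shift_above (p (Suc n))" and ?M = "match p n" and ?M' = "match p (Suc n)"
  let ?b = "{p (Suc n) + 1, 2 * Suc n}" and ?ms = "sorted_list_of_set (Max ` match p n)"
  from assms have g: "growth_sequence n p" and p: "p (Suc n) \<le> 2 * n"
    by (auto simp: growth_sequence_Suc)
  note inj = inj_on_Max_match[OF g] and inj' = inj_on_Max_match[OF assms]
  have Max_b: "Max ?b = 2 * Suc n" and Min_b: "Min ?b = p (Suc n) + 1"
    using p by auto
  have maxima: "Max ` ?M' = insert (2 * Suc n) (?f ` Max ` ?M)"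
    unfolding match_Suc image_insert Max_b image_image
    by (simp add: Max_image_shift_above[OF g] cong: image_cong)
  have sorted: "sorted_wrt (<) (map ?f ?ms @ [2 * Suc n])"
    using strict_sorted_list_of_set[of "Max ` ?M"]
      Max_shifted_less[OF g, of _ "p (Suc n)"]
    by (auto simp: sorted_wrt_append sorted_wrt_map finite_match Max_image_shift_above[OF g]
        strict_mono_less[OF strict_mono_shift_above])
  have ms: "sorted_list_of_set (Max ` ?M') = map ?f ?ms @ [2 * Suc n]"
  proof (rule strict_sorted_equal[OF sorted])
    show "sorted_wrt (<) (sorted_list_of_set (Max ` ?M'))"
      using sorted_list_of_set.strict_sorted_key_list_of_set by simp
    show "set (sorted_list_of_set (Max ` ?M')) = set (map ?f ?ms @ [2 * Suc n])"
      unfolding maxima by (subst set_sorted_list_of_set) (simp_all add: finite_match)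
  qed
  have old: "Min (THE e. e \<in> ?M' \<and> Max e = ?f m) = ?f (Min (THE e. e \<in> ?M \<and> Max e = m))"
    if "m \<in> Max ` ?M" for m
  proof -
    from that obtain e where e: "e \<in> ?M" "m = Max e" by auto
    have "?f ` e \<in> ?M'" using e unfolding match_Suc by auto
    from the_edge_with_Max[OF inj' this] show ?thesis
      using the_edge_with_Max[OF inj e(1)] e
      by (simp add: Max_image_shift_above[OF g] Min_image_shift_above[OF g] del: match.simps)
  qed
  have new: "Min (THE e. e \<in> ?M' \<and> Max e = 2 * Suc n) = p (Suc n) + 1"
    using the_edge_with_Max[OF inj', of ?b] unfolding Max_b
    by (simp only: Min_b match_Suc insert_iff simp_thms)
  show ?thesis
    unfolding min_word_def ms using old new by (simp add: finite_match del: match.simps)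
qed

lemma min_word_match_0: "min_word (match p 0) = []"
  by (simp add: min_word_def)

lemma length_min_word_match: "growth_sequence n p \<Longrightarrow> length (min_word (match p n)) = n"
proof (induction n)
  case (Suc n)
  then show ?case
    by (simp add: min_word_match_Suc growth_sequence_Suc del: match.simps)
qed (simp add: min_word_match_0 del: match.simps)

lemma last_min_word_match:
  assumes "growth_sequence n p" "n \<ge> 1"
  shows "min_word (match p n) \<noteq> [] \<and> last (min_word (match p n)) = p n + 1"
proof -
  obtain m where n: "n = Suc m" using assms(2) by (cases n) auto
  then have "growth_sequence (Suc m) p" using assms(1) by simp
  from min_word_match_Suc[OF this] show ?thesis unfolding n by (simp del: match.simps)
qed

lemma DES_min_word_match:
  "growth_sequence n p \<Longrightarrow> DES (min_word (match p n)) = weak_drops p n"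
proof (induction n)
  case 0
  then show ?case by (simp add: min_word_match_0 DES_def del: match.simps)
next
  case (Suc n)
  let ?w = "min_word (match p n)" and ?f = "shift_above (p (Suc n))"
  from Suc have g: "growth_sequence n p" by (simp add: growth_sequence_Suc)
  \<comment> \<open>The old last letter \<open>p n + 1\<close> is raised to \<open>p n + 2\<close>
    exactly if \<open>p (Suc n) \<le> p n\<close>, and only then does it exceed the appended letter.
    The raise is what makes equality a descent.\<close>
  have "last (map ?f ?w) > p (Suc n) + 1 \<longleftrightarrow> p (Suc n) \<le> p n" if "n \<ge> 1"
    using last_min_word_match[OF g that] by (auto simp: last_map shift_above_def)
  then have "{i. i = n \<and> ?w \<noteq> [] \<and> last (map ?f ?w) > p (Suc n) + 1} =
      {i. i = n \<and> 1 \<le> n \<and> p (Suc n) \<le> p n}"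
    using length_min_word_match[OF g] by (cases "n = 0") auto
  then show ?case
    unfolding min_word_match_Suc[OF Suc.prems] DES_snoc DES_map[OF strict_mono_shift_above]
      Suc.IH[OF g] weak_drops_Suc
    by (simp add: length_min_word_match[OF g] del: match.simps)
qed


section \<open>The labeled Dyck path\<close>

lemma set_labeled_word: "set (labeled_word p n) = {Up, Down} \<times> {1..n}"
proof (induction n)
  case (Suc n)
  have "set (labeled_word p (Suc n)) = {(Up, Suc n), (Down, Suc n)} \<union> set (labeled_word p n)"
    using set_append[of "take (p (Suc n)) (labeled_word p n)" "drop (p (Suc n)) (labeled_word p n)"]
    by auto
  then show ?case using Suc.IH by (auto simp: atLeastAtMostSuc_conv)
qed simp

lemma distinct_labeled_word: "distinct (labeled_word p n)"
proof (induction n)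
  case (Suc n)
  have new: "(x, Suc n) \<notin> set (take k (labeled_word p n))"
    "(x, Suc n) \<notin> set (drop k (labeled_word p n))" for x k
    using set_labeled_word[of p n] by (auto dest!: in_set_takeD in_set_dropD)
  show ?case
    using Suc.IH new by (auto simp: set_take_disj_set_drop_if_distinct)
qed simp

lemma length_labeled_word: "length (labeled_word p n) = 2 * n"
  by (induction n) auto

section \<open>Chords of the grown path and their labels\<close>

lemma labeled_word_at_up:
  assumes "c \<in> chords (grown_path p n)"
  shows "fst c - 1 < length (labeled_word p n)"
    and "labeled_word p n ! (fst c - 1) = (Up, grown_labeling p n c)"
proof -
  show l: "fst c - 1 < length (labeled_word p n)"
    using assms by (auto simp: chords_def grown_path_def)
  show "labeled_word p n ! (fst c - 1) = (Up, grown_labeling p n c)"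
    using assms l by (auto simp: chords_def grown_path_def grown_labeling_def prod_eq_iff)
qed

text \<open>Splittings instead of \<open>take k\<close> allow an insertion to be treated by cases on
  concatenations.\<close>

lemma dyck_word_iff_prefixes:
  "dyck_word w \<longleftrightarrow> count_list w Up = count_list w Down \<and>
     (\<forall>u v. w = u @ v \<longrightarrow> count_list u Down \<le> count_list u Up)"
proof -
  have "(\<forall>k\<le>length w. count_list (take k w) Down \<le> count_list (take k w) Up) \<longleftrightarrow>
      (\<forall>u v. w = u @ v \<longrightarrow> count_list u Down \<le> count_list u Up)"
    by (metis append_eq_conv_conj append_take_drop_id length_append le_add1)
  then show ?thesis by (simp add: dyck_word_def)
qed

text \<open>A prefix of the enlarged word has the same surplus of up steps as some prefix of the old
  word, plus one if it ends between the two new letters.\<close>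

lemma dyck_word_insert_peak:
  assumes "dyck_word (u @ v)"
  shows "dyck_word (u @ [Up, Down] @ v)"
proof -
  have pre: "count_list x Down \<le> count_list x Up" if "u @ v = x @ y" for x y
    using assms that by (simp add: dyck_word_iff_prefixes)
  have "count_list x Down \<le> count_list x Up" if "u @ [Up, Down] @ v = x @ y" for x y
  proof -
    from that consider (left) us where "u = x @ us" | (mid) "x = u @ [Up]"
      | (right) us where "x = u @ [Up, Down] @ us" "v = us @ y"
      by (fastforce simp: append_eq_append_conv2 append_eq_Cons_conv Cons_eq_append_conv)
    then show ?thesis
    proof cases
      case left
      then show ?thesis using pre[of x "us @ v"] by simp
    next
      case mid
      then show ?thesis using pre[of u v] by simp
    next
      case right
      then show ?thesis using pre[of "u @ us" y] by simp
    qed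
  qed
  moreover have "count_list (u @ v) Up = count_list (u @ v) Down"
    using assms by (simp add: dyck_word_def)
  ultimately show ?thesis by (auto simp: dyck_word_iff_prefixes)
qed

text \<open>If \<open>b < b'\<close>, the balanced word between \<open>a\<close> and
  \<open>b\<close> followed by the down step \<open>b\<close> would be a prefix of the interior of
  \<open>(a, b')\<close> with more down steps than up steps.\<close>

lemma chord_unique:
  assumes "(a, b) \<in> chords w" "(a, b') \<in> chords w"
  shows "b = b'"
proof -
  have False if c: "(a, b) \<in> chords w" "(a, b') \<in> chords w" and less: "b < b'" for b b'
  proof -
    let ?v = "take (b' - a - 1) (drop a w)"
    from c have *: "1 \<le> a" "a < b" "b' \<le> length w" "w ! (b - 1) = Down"
      "dyck_word (take (b - a - 1) (drop a w))" "dyck_word ?v"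
      by (auto simp: chords_def)
    have "take (b - a) ?v = take (Suc (b - a - 1)) (drop a w)"
      using less * by (simp add: min_absorb1 Suc_diff_Suc)
    also have "\<dots> = take (b - a - 1) (drop a w) @ [Down]"
      using less * by (subst take_Suc_conv_app_nth) auto
    finally have "count_list (take (b - a) ?v) Down > count_list (take (b - a) ?v) Up"
      using *(5) by (simp add: dyck_word_def)
    moreover have "b - a \<le> length ?v" using less * by auto
    ultimately show False using *(6) unfolding dyck_word_def by (metis not_less)
  qed
  from this[of b b'] this[of b' b] assms show ?thesis by (metis linorder_neqE_nat)
qed

text \<open>Links the two notions of a pair: \<open>chords\<close> goes by balance,
  \<open>labeled_word\<close> by labels. A later peak falls before, between or after the two letters
  of label \<open>i\<close>; only between them does it change the inner word, which stays
  balanced.\<close>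

lemma labeled_word_chord:
  assumes "i \<in> {1..n}"
  shows "\<exists>xs ys zs. labeled_word p n = xs @ (Up, i) # ys @ (Down, i) # zs \<and> dyck_word (map fst ys)"
  using assms
proof (induction n)
  case (Suc n)
  let ?k = "p (Suc n)" and ?UD = "[(Up, Suc n), (Down, Suc n)]"
  show ?case
  proof (cases "i = Suc n")
    case True
    have "labeled_word p (Suc n) = take ?k (labeled_word p n) @ (Up, i) # [] @ (Down, i) #
        drop ?k (labeled_word p n)" by (simp add: True)
    moreover have "dyck_word (map fst [])" by (simp add: dyck_word_def)
    ultimately show ?thesis by blast
  next
    case False
    then obtain xs ys zs where w: "labeled_word p n = xs @ (Up, i) # ys @ (Down, i) # zs"
      and ys: "dyck_word (map fst ys)" using Suc by auto
    obtain u v where uv: "labeled_word p n = u @ v"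
      and w': "labeled_word p (Suc n) = u @ ?UD @ v"
      by (metis append_take_drop_id labeled_word.simps(2))
    from w uv have "u @ v = xs @ (Up, i) # ys @ (Down, i) # zs" by simp
    then consider
      (left) us where "xs = u @ us" "v = us @ (Up, i) # ys @ (Down, i) # zs"
      | (mid) us vs where "u = xs @ (Up, i) # us" "ys = us @ vs" "v = vs @ (Down, i) # zs"
      | (right) us where "u = xs @ (Up, i) # ys @ (Down, i) # us" "zs = us @ v"
      by (fastforce simp: append_eq_append_conv2 append_eq_Cons_conv Cons_eq_append_conv)
    then show ?thesis
    proof cases
      case left
      then have "labeled_word p (Suc n) = (u @ ?UD @ us) @ (Up, i) # ys @ (Down, i) # zs"
        by (simp only: w' append.simps append_assoc)
      then show ?thesis using ys by blast
    next
      case mid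
      then have "labeled_word p (Suc n) = xs @ (Up, i) # (us @ ?UD @ vs) @ (Down, i) # zs"
        by (simp only: w' append.simps append_assoc)
      moreover have "dyck_word (map fst (us @ ?UD @ vs))"
        using dyck_word_insert_peak[of "map fst us" "map fst vs"] ys mid by simp
      ultimately show ?thesis by blast
    next
      case right
      then have "labeled_word p (Suc n) = xs @ (Up, i) # ys @ (Down, i) # (us @ ?UD @ v)"
        by (simp only: w' append.simps append_assoc)
      then show ?thesis using ys by blast
    qed
  qed
qed simp

lemma grown_labeling_surj:
  assumes "i \<in> {1..n}"
  shows "\<exists>c\<in>chords (grown_path p n). grown_labeling p n c = i"
proof -
  obtain xs ys zs where w: "labeled_word p n = xs @ (Up, i) # ys @ (Down, i) # zs"
    and ys: "dyck_word (map fst ys)" using labeled_word_chord[OF assms] by blast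
  \<comment> \<open>Steps are numbered from 1 while list indices start at 0, hence the offsets 1 and
    2.\<close>
  let ?c = "(length xs + 1, length xs + length ys + 2)"
  have "?c \<in> chords (grown_path p n)"
    using ys by (simp add: chords_def grown_path_def w nth_append)
  moreover have "grown_labeling p n ?c = i"
    by (simp add: grown_labeling_def w nth_append)
  ultimately show ?thesis by blast
qed

text \<open>Letters are distinct, so equal labels force the same up step, and the up step determines
  the chord. With surjectivity this gives \<open>the_inv_into\<close> its intended meaning.\<close>

lemma inj_on_grown_labeling: "inj_on (grown_labeling p n) (chords (grown_path p n))"
proof (rule inj_onI)
  fix c c' assume c: "c \<in> chords (grown_path p n)" "c' \<in> chords (grown_path p n)"
    and eq: "grown_labeling p n c = grown_labeling p n c'"
  have "fst c - 1 = fst c' - 1"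
    using nth_eq_iff_index_eq[OF distinct_labeled_word] labeled_word_at_up[OF c(1)]
      labeled_word_at_up[OF c(2)] eq by metis
  moreover have "fst c \<ge> 1" "fst c' \<ge> 1" using c by (auto simp: chords_def)
  ultimately have "fst c = fst c'" by simp
  then show "c = c'" using chord_unique c by (metis prod.collapse)
qed

section \<open>Left-to-right order of the up steps\<close>

lemma finite_chords: "finite (chords w)"
  by (rule finite_subset[of _ "{..length w} \<times> {..length w}"]) (auto simp: chords_def)

text \<open>\<open>L0\<close> counts nested initial segments; when \<open>fst c < fst c'\<close>,
  the chord \<open>c'\<close> itself makes the inclusion strict.\<close>

lemma L0_less_iff:
  assumes "c \<in> chords w" "c' \<in> chords w"
  shows "L0 w c < L0 w c' \<longleftrightarrow> fst c < fst c'"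
proof -
  have le: "L0 w x \<le> L0 w y" if "fst x \<le> fst y" for x y
    unfolding L0_def using that finite_chords[of w] by (auto intro!: card_mono)
  have "L0 w c < L0 w c'" if "fst c < fst c'"
  proof -
    have "c' \<in> {x \<in> chords w. fst x \<le> fst c'} - {x \<in> chords w. fst x \<le> fst c}"
      using that assms by simp
    then have "{x \<in> chords w. fst x \<le> fst c} \<subset> {x \<in> chords w. fst x \<le> fst c'}"
      using that by fastforce
    then show ?thesis
      unfolding L0_def using finite_chords[of w] by (intro psubset_card_mono) auto
  qed
  then show ?thesis using le[of c' c] by (meson not_le)
qed

text \<open>Subsequences express the left-to-right order in a form that survives later insertions;
  distinctness turns it back into a comparison of positions.\<close>

lemma subseq_nth_less:
  assumes "subseq [x, y] w" "distinct w" "a < length w" "w ! a = x" "b < length w" "w ! b = y"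
  shows "a < b"
proof -
  obtain us vs where w: "w = us @ x # vs" and y: "y \<in> set vs"
    using assms(1) by (auto dest!: list_emb_ConsD simp: subseq_singleton_left)
  then have "a = length us"
    using assms nth_eq_iff_index_eq[OF assms(2), of a "length us"] by simp
  moreover obtain j where "j < length vs" "vs ! j = y" using y by (auto simp: in_set_conv_nth)
  then have "b = length us + Suc j"
    using assms nth_eq_iff_index_eq[OF assms(2), of b "length us + Suc j"] w
    by (simp add: nth_append)
  ultimately show ?thesis by simp
qed

lemma subseq_labeled_word_Suc: "subseq (labeled_word p n) (labeled_word p (Suc n))"
proof -
  have "subseq (take k w @ [] @ drop k w) (take k w @ ys @ drop k w)"
    for k and w ys :: "(step \<times> nat) list"
    by (intro list_emb_append_mono) auto
  from this[of "p (Suc n)" "labeled_word p n" "[(Up, Suc n), (Down, Suc n)]"] show ?thesis by simp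
qed

lemma subseq_labeled_word_mono: "m \<le> n \<Longrightarrow> subseq (labeled_word p m) (labeled_word p n)"
proof (induction n rule: dec_induct)
  case (step n)
  then show ?case using subseq_labeled_word_Suc subseq_order.trans by blast
qed simp

lemma subseq_up_steps:
  assumes "1 \<le> i" "growth_sequence (Suc i) p"
  shows "subseq (if p (Suc i) \<le> p i then [(Up, Suc i), (Up, i)] else [(Up, i), (Up, Suc i)])
    (labeled_word p (Suc i))"
proof -
  obtain m where i: "i = Suc m" using assms(1) by (cases i) auto
  let ?w = "labeled_word p m" and ?k = "p i" and ?k' = "p (Suc i)"
  \<comment> \<open>This bound keeps \<open>take\<close> from being cut short, so in
    \<open>labeled_word p i\<close> the letter \<open>(Up, i)\<close> has index exactly
    \<open>p i\<close>. It is right of the next cut iff \<open>p (Suc i) \<le> p i\<close>.\<close>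
  have k: "?k \<le> length ?w"
    using assms by (simp add: length_labeled_word growth_sequence_Suc i)
  have w: "labeled_word p i = take ?k ?w @ [(Up, i), (Down, i)] @ drop ?k ?w"
    by (simp add: i)
  show ?thesis
  proof (cases "?k' \<le> ?k")
    case True
    then have "(Up, i) \<in> set (drop ?k' (labeled_word p i))"
      using k by (simp add: w)
    then show ?thesis
      using True by (auto simp: subseq_singleton_left intro!: list_emb_append2)
  next
    case False
    then have "(Up, i) \<in> set (take ?k' (labeled_word p i))"
      using k by (simp add: w take_Cons')
    then have "subseq ([(Up, i)] @ [(Up, Suc i)]) (labeled_word p (Suc i))"
      unfolding labeled_word.simps(2)
      by (intro list_emb_append_mono) (auto simp: subseq_singleton_left)
    then show ?thesis using False by simp
  qed
qed

lemma DES_sigma: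
  assumes "growth_sequence n p"
  shows "DES (sigma p n) = weak_drops p n"
proof -
  let ?P = "grown_path p n" and ?L = "grown_labeling p n"
  let ?c = "the_inv_into (chords ?P) ?L"
  have c: "?c i \<in> chords ?P" "?L (?c i) = i" if "i \<in> {1..n}" for i
  proof -
    have "i \<in> ?L ` chords ?P" using grown_labeling_surj[OF that] by force
    then show "?c i \<in> chords ?P" "?L (?c i) = i"
      using the_inv_into_into[OF inj_on_grown_labeling _ subset_refl]
        f_the_inv_into_f[OF inj_on_grown_labeling] by blast+
  qed
  have "sigma p n ! (i - 1) > sigma p n ! i \<longleftrightarrow> p (Suc i) \<le> p i" if i: "1 \<le> i" "i < n" for i
  proof -
    let ?a = "?c i" and ?b = "?c (Suc i)"
    have a: "?a \<in> chords ?P" "?L ?a = i" and b: "?b \<in> chords ?P" "?L ?b = Suc i"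
      using c[of i] c[of "Suc i"] i by auto
    have pos: "fst ?a \<ge> 1" "fst ?b \<ge> 1" using a(1) b(1) by (auto simp: chords_def)
    note at = labeled_word_at_up[OF a(1), unfolded a(2)] labeled_word_at_up[OF b(1), unfolded b(2)]
    have "growth_sequence (Suc i) p" using assms i by (auto simp: growth_sequence_def)
    \<comment> \<open>The two up steps are compared at stage \<open>Suc i\<close>, when the second
      one has just appeared, and the order is carried on to stage \<open>n\<close>.\<close>
    from subseq_up_steps[OF i(1) this]
    have sub: "subseq (if p (Suc i) \<le> p i then [(Up, Suc i), (Up, i)] else [(Up, i), (Up, Suc i)])
        (labeled_word p n)"
      by (rule subseq_order.trans) (rule subseq_labeled_word_mono, use i in simp)
    have "fst ?b < fst ?a \<longleftrightarrow> p (Suc i) \<le> p i"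
    proof (cases "p (Suc i) \<le> p i")
      case True
      then have "fst ?b - 1 < fst ?a - 1"
        using sub by (intro subseq_nth_less[OF _ distinct_labeled_word at(3,4,1,2)]) simp
      then show ?thesis using True by linarith
    next
      case False
      then have "fst ?a - 1 < fst ?b - 1"
        using sub by (intro subseq_nth_less[OF _ distinct_labeled_word at]) simp
      then show ?thesis using False by linarith
    qed
    moreover have "sigma p n ! (i - 1) = L0 ?P ?a" "sigma p n ! i = L0 ?P ?b"
      using i by (simp_all add: sigma_def del: upt_Suc)
    ultimately show ?thesis using L0_less_iff[OF b(1) a(1)] by simp
  qed
  moreover have "length (sigma p n) = n" by (simp add: sigma_def)
  ultimately show ?thesis by (auto simp: DES_def weak_drops_def)
qed


section \<open>Disagreements of the grown tiling\<close>

definition path :: "nat \<Rightarrow> (int \<Rightarrow> int) \<Rightarrow> point set" where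
  "path m f = {(x, f x) | x. - int m \<le> x \<and> x \<le> int m}"

lemma mem_path [simp]: "(x, y) \<in> path m f \<longleftrightarrow> - int m \<le> x \<and> x \<le> int m \<and> y = f x"
  by (auto simp: path_def)

lemma up_into_path [simp]:
  "up_into (path m f) c \<longleftrightarrow> - int m < c \<and> c \<le> int m \<and> f c = f (c - 1) + 1"
  by (auto simp: up_into_def)

lemma down_into_path [simp]:
  "down_into (path m f) c \<longleftrightarrow> - int m < c \<and> c \<le> int m \<and> f c = f (c - 1) - 1"
  by (auto simp: down_into_def)

text \<open>The path is cut open at column \<open>s\<close>: its point there is doubled to columns
  \<open>s - 1\<close> and \<open>s + 1\<close>, with a peak between the copies.\<close>

definition spread_fun :: "int \<Rightarrow> (int \<Rightarrow> int) \<Rightarrow> int \<Rightarrow> int" where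
  "spread_fun s f x = (if x < s then f (x + 1) else if x = s then f s + 1 else f (x - 1))"

lemma mem_spread:
  "(x, y) \<in> spread s P \<longleftrightarrow>
     (x < s \<and> (x + 1, y) \<in> P) \<or> (x = s \<and> (s, y - 1) \<in> P) \<or> (x > s \<and> (x - 1, y) \<in> P)"
proof -
  have "(x, y) \<in> spread s P \<longleftrightarrow> (\<exists>x'. (x', y) \<in> P \<and> x = x' - 1 \<and> x' \<le> s) \<or>
      (\<exists>y'. (x, y') \<in> P \<and> y = y' + 1 \<and> x = s) \<or> (\<exists>x'. (x', y) \<in> P \<and> x = x' + 1 \<and> x' \<ge> s)"
    unfolding spread_def by auto
  also have "(\<exists>x'. (x', y) \<in> P \<and> x = x' - 1 \<and> x' \<le> s) \<longleftrightarrow> x < s \<and> (x + 1, y) \<in> P"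
    by (metis add_diff_cancel diff_add_cancel zle_add1_eq_le add_less_cancel_right)
  also have "(\<exists>y'. (x, y') \<in> P \<and> y = y' + 1 \<and> x = s) \<longleftrightarrow> x = s \<and> (s, y - 1) \<in> P"
    by (metis add_diff_cancel diff_add_cancel)
  also have "(\<exists>x'. (x', y) \<in> P \<and> x = x' + 1 \<and> x' \<ge> s) \<longleftrightarrow> x > s \<and> (x - 1, y) \<in> P"
    by (metis add_diff_cancel diff_add_cancel zle_add1_eq_le zless_add1_eq less_add_one le_less)
  finally show ?thesis .
qed

lemma spread_path:
  assumes "- int m \<le> s" "s \<le> int m"
  shows "spread s (path m f) = path (Suc m) (spread_fun s f)"
  using assms by (auto simp: mem_spread spread_fun_def)

text \<open>Steps ending at or before column \<open>s\<close> move left by one, the others right by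
  one. The new peak supplies an up step into \<open>s\<close> and, in the companion lemma, a down
  step into \<open>s + 1\<close>.\<close>

lemma up_into_spread_path:
  assumes "- int m \<le> s" "s \<le> int m"
  shows "up_into (spread s (path m f)) c \<longleftrightarrow>
    (c < s \<and> up_into (path m f) (c + 1)) \<or> c = s \<or> (c > s + 1 \<and> up_into (path m f) (c - 1))"
proof -
  consider "c < s" | "c = s" | "c = s + 1" | "c > s + 1" by linarith
  then show ?thesis
    using assms unfolding spread_path[OF assms] by cases (auto simp: spread_fun_def)
qed

lemma down_into_spread_path:
  assumes "- int m \<le> s" "s \<le> int m"
  shows "down_into (spread s (path m f)) c \<longleftrightarrow>
    (c < s \<and> down_into (path m f) (c + 1)) \<or> c = s + 1 \<or>
    (c > s + 1 \<and> down_into (path m f) (c - 1))"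
proof -
  consider "c < s" | "c = s" | "c = s + 1" | "c > s + 1" by linarith
  then show ?thesis
    using assms unfolding spread_path[OF assms] by cases (auto simp: spread_fun_def)
qed

text \<open>A tile meeting column \<open>s\<close> contains three points after spreading, so only the one-box tiles
  away from column \<open>s\<close> give one-box tiles.\<close>

lemma singleton_spread_iff:
  assumes "x \<ge> s"
  shows "{(x, y)} \<in> spread s ` A \<longleftrightarrow> x > s + 1 \<and> {(x - 1, y)} \<in> A"
proof
  assume "{(x, y)} \<in> spread s ` A"
  then obtain P where P: "P \<in> A" "spread s P = {(x, y)}" by blast
  have mem: "(a, b) \<in> spread s P \<longleftrightarrow> a = x \<and> b = y" for a b
    using P(2) by simp
  have col: "(s, b) \<notin> P" for b
    using mem[of "s - 1" b] mem[of "s + 1" b] by (auto simp: mem_spread)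
  \<comment> \<open>Such a point would reappear in column \<open>a - 1\<close>, which is less than
    \<open>s\<close> and so differs from \<open>x\<close>.\<close>
  have lo: "(a, b) \<notin> P" if "a < s" for a b
    using mem[of "a - 1" b] that assms by (auto simp: mem_spread)
  have hi: "(a, b) \<in> P \<longleftrightarrow> a = x - 1 \<and> b = y" if "a > s" for a b
    using mem[of "a + 1" b] that by (auto simp: mem_spread)
  have "(x, y) \<in> spread s P" using mem by simp
  then have "x > s" "(x - 1, y) \<in> P" using assms col by (auto simp: mem_spread)
  then have "x - 1 > s" using col[of y] by (cases "x - 1 = s") auto
  moreover have "P = {(x - 1, y)}"
  proof (intro set_eqI, clarify)
    fix a b
    show "(a, b) \<in> P \<longleftrightarrow> (a, b) \<in> {(x - 1, y)}"
      using lo[of a b] col[of b] hi[of a b] \<open>x - 1 > s\<close>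
      by (cases a s rule: linorder_cases) auto
  qed
  ultimately show "x > s + 1 \<and> {(x - 1, y)} \<in> A" using P(1) by simp
next
  assume r: "x > s + 1 \<and> {(x - 1, y)} \<in> A"
  have "spread s {(x - 1, y)} = {(x, y)}"
    using r by (auto simp: mem_spread)
  then show "{(x, y)} \<in> spread s ` A" using r by (metis imageI)
qed

section \<open>Disagreements and eligible columns under spreading\<close>

definition path_tiling :: "nat \<Rightarrow> (int \<Rightarrow> int) \<Rightarrow> (int \<Rightarrow> int) \<Rightarrow> tiling \<Rightarrow> bool" where
  "path_tiling m l u T \<longleftrightarrow>
     tiling_order T = m \<and> lower_path T = path m l \<and> upper_path T = path m u"

lemma eligible_bounds:
  assumes "path_tiling m l u T" "eligible T c"
  shows "- int m < c" "c \<le> int m"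
  using assms by (auto simp: path_tiling_def eligible_def)

text \<open>The set behind \<open>dis\<close>, indexed by columns instead of step numbers because
  spreading and adding boxes act on columns.\<close>

definition disagreements :: "tiling \<Rightarrow> int set" where
  "disagreements T = {c. down_into (lower_path T) c \<and> up_into (upper_path T) c}"

lemma finite_disagreements:
  assumes "path_tiling m l u T"
  shows "finite (disagreements T)"
  by (rule finite_subset[of _ "{- int m..int m}"])
    (use assms in \<open>auto simp: disagreements_def path_tiling_def\<close>)

lemma dis_eq_card_disagreements:
  assumes "path_tiling m l u T"
  shows "dis T = card (disagreements T)"
  unfolding dis_def
proof (rule bij_betw_same_card[of "\<lambda>k. int k - int m"],
    rule bij_betw_byWitness[where f' = "\<lambda>c. nat (c + int m)"])
qed (use assms in \<open>auto simp: disagreements_def path_tiling_def\<close>)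

lemma path_tiling_spread:
  assumes "path_tiling m l u T" "- int m \<le> s" "s \<le> int m"
  shows "path_tiling (Suc m) (spread_fun s l) (spread_fun s u) (spread_tiling s T)"
  using assms by (simp add: path_tiling_def spread_tiling_def spread_path)

text \<open>Old disagreements move with their steps. The inserted peak is the same in both paths and
  contributes none.\<close>

lemma card_disagreements_spread:
  assumes "path_tiling m l u T" "- int m \<le> s" "s \<le> int m"
  shows "card (disagreements (spread_tiling s T)) = card (disagreements T)"
proof (rule sym, rule bij_betw_same_card[of "\<lambda>c. if c \<le> s then c - 1 else c + 1"],
    rule bij_betw_byWitness[where f' = "\<lambda>c. if c < s then c + 1 else c - 1"])
qed (use assms in \<open>auto simp: disagreements_def path_tiling_def spread_tiling_def
  up_into_spread_path down_into_spread_path simp del: up_into_path down_into_path\<close>)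

text \<open>The new peak is not the top of a one-box tile, and further right both up steps and
  one-box tiles move together. Columns from \<open>s\<close> on suffice: \<open>s\<close> is
  eligible, so the special column is at least \<open>s\<close>.\<close>

lemma eligible_spread_iff:
  assumes "path_tiling m l u T" "- int m \<le> s" "s \<le> int m" "c \<ge> s"
  shows "eligible (spread_tiling s T) c \<longleftrightarrow> c = s \<or> (c > s + 1 \<and> eligible T (c - 1))"
  using assms
  by (auto simp: eligible_def path_tiling_def spread_tiling_def up_into_spread_path
      singleton_spread_iff mem_spread simp del: up_into_path)

section \<open>Adding one-box tiles\<close>

definition raise_fun :: "int \<Rightarrow> int \<Rightarrow> (int \<Rightarrow> int) \<Rightarrow> int \<Rightarrow> int" where
  "raise_fun s q f x = (if s < x \<and> x < q then f x + 2 else f x)"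

lemma path_tiling_add_boxes:
  assumes "path_tiling m l u T"
  shows "path_tiling m l (raise_fun s q u) (add_boxes s q T)"
  using assms by (auto simp: path_tiling_def add_boxes_def raise_fun_def)

lemma add_boxes_tiles:
  assumes "path_tiling m l u T"
  shows "{(c, y)} \<in> tiles (add_boxes s q T) \<longleftrightarrow>
    {(c, y)} \<in> tiles T \<or> (s < c \<and> c < q \<and> (c, y) \<in> path m u)"
  using assms by (auto simp: path_tiling_def add_boxes_def)

text \<open>\<open>Max\<close> is informative only on a finite nonempty set: the path bounds the
  eligible columns, and \<open>c\<close> is one of them.\<close>

lemma special_column_greatest:
  assumes "path_tiling m l u T" "eligible T c"
  shows "eligible T (special_column T)" and "c \<le> special_column T"
proof -
  have "finite {c. eligible T c}"
    by (rule finite_subset[of _ "{- int m..int m}"]) (use eligible_bounds[OF assms(1)] in force)+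
  from Max_in[OF this] Max_ge[OF this] assms(2)
  show "eligible T (special_column T)" "c \<le> special_column T"
    unfolding special_column_def by auto
qed

text \<open>With \<open>q\<close> the special column, adding the boxes makes \<open>s\<close> the
  new special column, so the next growth step is compared with this one.\<close>

lemma eligible_add_boxes:
  assumes T: "path_tiling m l u T" and s: "eligible T s" and q: "eligible T q"
    and max: "\<And>c. eligible T c \<Longrightarrow> c \<le> q" and gap: "q = s \<or> q > s + 1"
  shows "eligible (add_boxes s q T) s"
    and "eligible (add_boxes s q T) c \<Longrightarrow> c \<le> s"
proof -
  let ?T = "add_boxes s q T"
  note bounds = eligible_bounds[OF T s] eligible_bounds[OF T q]
  have T': "path_tiling m l (raise_fun s q u) ?T" by (rule path_tiling_add_boxes[OF T])
  note simps = T[unfolded path_tiling_def] T'[unfolded path_tiling_def] eligible_def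
    add_boxes_tiles[OF T] raise_fun_def
  show "eligible ?T s" using s by (auto simp: simps)
  assume c: "eligible ?T c"
  show "c \<le> s"
  proof (rule ccontr)
    assume "\<not> c \<le> s"
    then consider "c < q" | "c = q" "c > s" | "c > q" by linarith
    then show False
    proof cases
      \<comment> \<open>The raised point in column \<open>c\<close> is the top corner of the box
        just added there.\<close>
      case 1
      then show False using c \<open>\<not> c \<le> s\<close> bounds by (auto simp: simps)
    next
      \<comment> \<open>By \<open>gap\<close>, column \<open>q - 1\<close> is strictly right of
        \<open>s\<close> and is raised by 2, which turns the up step into \<open>q\<close> into a
        down step.\<close>
      case 2
      then show False using c q gap by (auto simp: simps)
    next
      \<comment> \<open>Nothing changes right of \<open>q\<close>, so \<open>c\<close> was already
        eligible, against the maximality of \<open>q\<close>.\<close>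
      case 3
      then have "eligible T c" using c \<open>\<not> c \<le> s\<close> by (auto simp: simps)
      then show False using max 3 by fastforce
    qed
  qed
qed

text \<open>Only the steps into \<open>s + 1\<close> and \<open>q\<close> of the upper path change.
  The first turns from down to up over a down step of the lower path, a new disagreement; the second
  turns from up to down over an up step, so none is lost.\<close>

lemma disagreements_add_boxes:
  assumes T: "path_tiling m l u T" and bounds: "- int m \<le> s" "q \<le> int m" and gap: "s + 1 < q"
    and down: "down_into (lower_path T) (s + 1)" "down_into (upper_path T) (s + 1)"
    and up: "up_into (lower_path T) q" "up_into (upper_path T) q"
  shows "card (disagreements (add_boxes s q T)) = Suc (card (disagreements T))"
proof -
  have T': "path_tiling m l (raise_fun s q u) (add_boxes s q T)"
    by (rule path_tiling_add_boxes[OF T])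
  note simps = T[unfolded path_tiling_def] T'[unfolded path_tiling_def] disagreements_def
    raise_fun_def
  have "c \<in> disagreements (add_boxes s q T) \<longleftrightarrow> c \<in> insert (s + 1) (disagreements T)" for c
  proof -
    consider "c \<le> s" | "c = s + 1" | "s + 1 < c" "c < q" | "c = q" | "c > q" by linarith
    then show ?thesis using gap down up bounds by cases (auto simp: simps)
  qed
  then have "disagreements (add_boxes s q T) = insert (s + 1) (disagreements T)" by blast
  moreover have "s + 1 \<notin> disagreements T" using down by (auto simp: simps)
  ultimately show ?thesis using finite_disagreements[OF T] by simp
qed

lemma disagreements_add_no_boxes: "disagreements (add_boxes s s T) = disagreements T"
proof -
  have "upper_path (add_boxes s s T) = upper_path T" "lower_path (add_boxes s s T) = lower_path T"
    by (auto simp: add_boxes_def)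
  then show ?thesis by (simp add: disagreements_def)
qed

text \<open>The premise \<open>up\<close> speaks of a greatest eligible column rather than
  \<open>special_column T\<close>, so it holds vacuously when no column is eligible, as at order 0.
  The conclusions on \<open>s\<close> restore it for the next step.\<close>

lemma rgrow_step:
  assumes T: "path_tiling m l u T" and s: "- int m \<le> s" "s \<le> int m"
    and up: "\<And>q. \<lbrakk>eligible T q; \<And>c. eligible T c \<Longrightarrow> c \<le> q\<rbrakk> \<Longrightarrow> up_into (lower_path T) q"
  shows "\<exists>l u. path_tiling (Suc m) l u (rgrow T s)"
    and "eligible (rgrow T s) s"
    and "eligible (rgrow T s) c \<Longrightarrow> c \<le> s"
    and "up_into (lower_path (rgrow T s)) s"
    and "card (disagreements (rgrow T s)) =
      card (disagreements T) + (if \<exists>c>s. eligible T c then 1 else 0)"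
proof -
  let ?S = "spread_tiling s T"
  let ?q = "special_column ?S"
  note eligible_iff = eligible_spread_iff[OF T s]
  have S: "path_tiling (Suc m) (spread_fun s l) (spread_fun s u) ?S"
    by (rule path_tiling_spread[OF T s])
  have S_s: "eligible ?S s" by (simp add: eligible_iff)
  note q = special_column_greatest[OF S S_s]
  have max: "c \<le> ?q" if "eligible ?S c" for c
    using special_column_greatest[OF S that] by simp
  \<comment> \<open>Column \<open>s + 1\<close> receives the down step of the new peak, so it is
    never eligible.\<close>
  have gap: "?q = s \<or> ?q > s + 1" using q eligible_iff[of ?q] by auto
  have rgrow: "rgrow T s = add_boxes s ?q ?S" by (simp add: rgrow_def Let_def)
  show path: "\<exists>l u. path_tiling (Suc m) l u (rgrow T s)"
    unfolding rgrow using path_tiling_add_boxes[OF S] by blast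
  show "eligible (rgrow T s) s" "eligible (rgrow T s) c \<Longrightarrow> c \<le> s"
    unfolding rgrow using eligible_add_boxes[OF S S_s q(1) max gap] by auto
  show "up_into (lower_path (rgrow T s)) s"
    using path_tiling_add_boxes[OF S, of s ?q] s
    by (auto simp: rgrow path_tiling_def spread_fun_def)
  show "card (disagreements (rgrow T s)) =
      card (disagreements T) + (if \<exists>c>s. eligible T c then 1 else 0)"
  proof (cases "?q = s")
    case True
    have "\<not> eligible T c" if "c > s" for c
      using max[of "c + 1"] eligible_iff[of "c + 1"] that True by auto
    then show ?thesis
      using True card_disagreements_spread[OF T s] disagreements_add_no_boxes[of s ?S]
      by (auto simp: rgrow)
  next
    case False
    then have "s + 1 < ?q" using gap by simp
    then have old: "eligible T (?q - 1)" using q eligible_iff[of ?q] by simp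
    \<comment> \<open>\<open>?q - 1\<close> is the greatest eligible column before spreading: an
      eligible \<open>c > s\<close> moves to \<open>c + 1\<close>, and any other is at most
      \<open>s\<close>. Hence \<open>up\<close> applies.\<close>
    have "up_into (lower_path T) (?q - 1)"
    proof (rule up[OF old])
      fix c assume "eligible T c"
      then show "c \<le> ?q - 1"
        using max[of "c + 1"] eligible_iff[of "c + 1"] \<open>s + 1 < ?q\<close> by (cases "c > s") auto
    qed
    then have "up_into (lower_path ?S) ?q"
      using \<open>s + 1 < ?q\<close> T up_into_spread_path[OF s]
      by (simp add: path_tiling_def spread_tiling_def del: up_into_path)
    moreover have "up_into (upper_path ?S) ?q" using q by (simp add: eligible_def)
    moreover have "down_into (lower_path ?S) (s + 1)" "down_into (upper_path ?S) (s + 1)"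
      using T down_into_spread_path[OF s]
      by (simp_all add: path_tiling_def spread_tiling_def del: down_into_path)
    ultimately have "card (disagreements (rgrow T s)) = Suc (card (disagreements ?S))"
      unfolding rgrow using \<open>s + 1 < ?q\<close> eligible_bounds[OF S] S_s q s
      by (intro disagreements_add_boxes[OF S]) auto
    moreover have "\<exists>c>s. eligible T c" using old \<open>s + 1 < ?q\<close> by (intro exI[of _ "?q - 1"]) auto
    ultimately show ?thesis using card_disagreements_spread[OF T s] by simp
  qed
qed

text \<open>The greatest eligible column is the one where the last growth took place. Its offset is
  \<open>n - 1\<close>, the order before that growth, and spreading at a column leaves the new peak
  in that column.\<close>

lemma DTR_invariants:
  assumes "growth_sequence n p"
  shows "(\<exists>l u. path_tiling n l u (DTR p n)) \<and>
    (\<forall>c. eligible (DTR p n) c \<longrightarrow> 1 \<le> n \<and> c \<le> int (p n) - int (n - 1)) \<and>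
    (1 \<le> n \<longrightarrow> eligible (DTR p n) (int (p n) - int (n - 1)) \<and>
       up_into (lower_path (DTR p n)) (int (p n) - int (n - 1))) \<and>
    card (disagreements (DTR p n)) = card (weak_drops p n)"
  using assms
proof (induction n)
  case 0
  have "{(0, 0)} = path 0 (\<lambda>_. 0)" by (auto simp: path_def)
  then have T: "path_tiling 0 (\<lambda>_. 0) (\<lambda>_. 0) (DTR p 0)" by (simp add: path_tiling_def)
  moreover have "\<not> eligible (DTR p 0) c" for c using eligible_bounds[OF T, of c] by auto
  moreover have "disagreements (DTR p 0) = {}" using T by (auto simp: disagreements_def path_tiling_def)
  ultimately show ?case by (auto simp del: DTR.simps)
next
  case (Suc n)
  let ?T = "DTR p n" and ?s = "int (p (Suc n)) - int n" and ?q = "int (p n) - int (n - 1)"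
  from Suc.prems have g: "growth_sequence n p" and p: "p (Suc n) \<le> 2 * n"
    by (simp_all add: growth_sequence_Suc)
  note IH = Suc.IH[OF g]
  then obtain l u where T: "path_tiling n l u ?T" by blast
  have s: "- int n \<le> ?s" "?s \<le> int n" using p by auto
  have up: "up_into (lower_path ?T) q" if "eligible ?T q" "\<And>c. eligible ?T c \<Longrightarrow> c \<le> q" for q
  proof -
    have "q = ?q" using IH that by (meson order_antisym)
    then show ?thesis using IH that by blast
  qed
  \<comment> \<open>As \<open>?q\<close> is the greatest eligible column, it alone decides. The
    offsets of \<open>?q\<close> and \<open>?s\<close> differ by one, so the strict inequality of
    columns becomes the weak one of positions.\<close>
  have "(\<exists>c>?s. eligible ?T c) \<longleftrightarrow> 1 \<le> n \<and> ?q > ?s"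
    using IH by (meson less_le_trans)
  also have "\<dots> \<longleftrightarrow> 1 \<le> n \<and> p (Suc n) \<le> p n" by auto
  finally have "card (disagreements (rgrow ?T ?s)) = card (weak_drops p (Suc n))"
    using rgrow_step(5)[OF T s up] IH by (simp add: card_weak_drops_Suc)
  then show ?case
    using rgrow_step(1,2,4)[OF T s up] rgrow_step(3)[OF T s up] by (simp del: up_into_path)
qed

lemma dis_DTR:
  assumes "growth_sequence n p"
  shows "dis (DTR p n) = card (weak_drops p n)"
  using DTR_invariants[OF assms] dis_eq_card_disagreements by metis

theorem theorem8:
  fixes n :: nat and p :: "nat \<Rightarrow> nat"
  assumes "growth_sequence n p"
  shows "DES (sigma p n) = DES (min_word (match p n)) \<and>
    dis (DTR p n) = des (min_word (match p n))"
  using assms by (simp add: DES_sigma DES_min_word_match dis_DTR des_def)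

end
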